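(* Let $M\subseteq\mathbb{R}[x,y]=\mathbb{R}[x_1,\dots,x_n,y_1,\dots,y_n]$ be a finitely generated hermitian module. If $M$ satisfies (Sf), i.e. if every tuple $T=(T_1,\dots,T_n)$ of pairwise commuting complex square matrices (of the same size) satisfying $p(T,T^* )\ge0$ for every $p\in M$ is normal, then the semi-algebraic set $X_M\subseteq\mathbb{C}^n$ does not contain an analytic disc.
   Context: $\mathbb{C}[z,\bar z]$ is the polynomial ring in $2n$ independent variables $z=(z_1,\dots,z_n)$, $\bar z=(\bar z_1,\dots,\bar z_n)$, with the conjugate-linear ring involution $*$ determined by $z_j^*=\bar z_j$. Its fixed ring is $\mathbb{R}[x,y]$, where $x_j=\frac12(z_j+\bar z_j)$, $y_j=\frac1{2i}(z_j-\bar z_j)$. For $f\in\mathbb{R}[x,y]$ and $a\in\mathbb{C}^n$, $f(a)\in\mathbb{R}$ is the value obtained by substituting $a$ for $z$ and $\bar a$ for $\bar z$. $\Sigma_h$ is the convex cone in $\mathbb{R}[x,y]$ generated by $\{pp^*: p\in\mathbb{C}[z]\}$. A hermitian module is a subset $M\subseteq\mathbb{R}[x,y]$ with $1\in M$, $M+M\subseteq M$ and $\Sigma_hM\subseteq M$; it is finitely generated if it is the smallest hermitian module containing some finite set $f_1,\dots,f_r$, i.e. $M=\Sigma_h+\Sigma_hf_1+\cdots+\Sigma_hf_r$. $X_M=\{a\in\mathbb{C}^n: g(a)\ge0\ \forall g\in M\}$. Hereditary calculus: for a commuting tuple $T$ of matrices and $f=\sum_{\alpha,\beta}a_{\alpha,\beta}z^\alpha\bar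 z^\beta$, $f(T,T^* )=\sum_{\alpha,\beta}a_{\alpha,\beta}T^{*\beta}T^\alpha$ (all adjoints to the left). A commuting tuple of matrices is normal if each of its entries is normal. An analytic disc is the image of a nonconstant holomorphic map $\varphi:\mathbb{D}\to\mathbb{C}^n$, where $\mathbb{D}$ is the open unit disc in $\mathbb{C}$. *)

theory Defs
  imports
    "HOL-Complex_Analysis.Complex_Analysis"
    "HOL-Library.Poly_Mapping"
    "Jordan_Normal_Form.Schur_Decomposition"
begin

text \<open>
  \<open>'n\<close> is the index type of the coordinates of \<open>\<complex>\<^sup>n\<close>. The key \<open>(\<alpha>, \<beta>)\<close> of a polynomial stands for
  the monomial \<open>z\<^sup>\<alpha> zbar\<^sup>\<beta>\<close>. Exponent pairs add componentwise, so the ring structure that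
  \<^theory>\<open>HOL-Library.Poly_Mapping\<close> puts on this type is that of \<open>\<complex>[z, zbar]\<close>.
\<close>

type_synonym 'n zpoly = "(('n \<Rightarrow>\<^sub>0 nat) \<times> ('n \<Rightarrow>\<^sub>0 nat)) \<Rightarrow>\<^sub>0 complex"

definition zvar :: "'n \<Rightarrow> 'n zpoly" where
  "zvar j = Poly_Mapping.single (Poly_Mapping.single j 1, 0) 1"

definition zbar :: "'n \<Rightarrow> 'n zpoly" where
  "zbar j = Poly_Mapping.single (0, Poly_Mapping.single j 1) 1"

definition Const :: "complex \<Rightarrow> 'n zpoly" where
  "Const c = Poly_Mapping.single 0 c"

text \<open>
  The involution \<open>*\<close>: the coefficient of \<open>z\<^sup>\<alpha> zbar\<^sup>\<beta>\<close> in \<open>hstar f\<close> is the conjugate of the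
  coefficient of \<open>z\<^sup>\<beta> zbar\<^sup>\<alpha>\<close> in \<open>f\<close>. The lemmas below are the properties that determine it.
\<close>

definition hstar :: "'n zpoly \<Rightarrow> 'n zpoly" where
  "hstar f = Poly_Mapping.map cnj (Poly_Mapping.map_key prod.swap f)"

lemma lookup_hstar: "Poly_Mapping.lookup (hstar f) (\<alpha>, \<beta>) = cnj (Poly_Mapping.lookup f (\<beta>, \<alpha>))"
  unfolding hstar_def
  by (simp add: Poly_Mapping.map.rep_eq Poly_Mapping.map_key.rep_eq when_def)

lemma hstar_single: "hstar (Poly_Mapping.single (\<alpha>, \<beta>) c) = Poly_Mapping.single (\<beta>, \<alpha>) (cnj c)"
  by (rule poly_mapping_eqI) (auto simp: lookup_hstar lookup_single when_def split: if_splits)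

lemma hstar_zvar: "hstar (zvar j) = zbar j"
  by (simp add: zvar_def zbar_def hstar_single)

lemma hstar_Const: "hstar (Const c) = Const (cnj c)"
  by (simp add: Const_def zero_prod_def hstar_single)

lemma hstar_hstar: "hstar (hstar f) = f"
  by (rule poly_mapping_eqI) (auto simp: lookup_hstar)

lemma hstar_zero: "hstar 0 = 0"
  by (rule poly_mapping_eqI) (auto simp: lookup_hstar)

lemma hstar_add: "hstar (f + g) = hstar f + hstar g"
  by (rule poly_mapping_eqI) (auto simp: lookup_hstar lookup_add)

lemma hstar_mult: "hstar (f * g) = hstar f * hstar g"
proof -
  have sums: "h = (\<Sum>k\<in>Poly_Mapping.keys h. Poly_Mapping.single k (Poly_Mapping.lookup h k))"
    for h :: "'a zpoly"
    by (rule poly_mapping_eqI)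
      (auto simp: lookup_sum lookup_single when_def sum.delta in_keys_iff)
  have hsum: "hstar (sum h A) = (\<Sum>a\<in>A. hstar (h a))" for h :: "'c \<Rightarrow> 'a zpoly" and A
    by (induction A rule: infinite_finite_induct)
      (auto simp: hstar_add hstar_zero)
  have single: "hstar (Poly_Mapping.single k c * Poly_Mapping.single l d) =
      hstar (Poly_Mapping.single k c) * hstar (Poly_Mapping.single l d)"
    for k l :: "('a \<Rightarrow>\<^sub>0 nat) \<times> ('a \<Rightarrow>\<^sub>0 nat)" and c d
    by (cases k, cases l) (simp add: mult_single hstar_single)
  show ?thesis
    by (subst (1 2) sums[of f], subst (1 2) sums[of g])
      (simp add: sum_product hsum single)
qed

text \<open>The fixed ring \<open>\<real>[x, y]\<close> of the involution.\<close>

definition real_polys :: "'n zpoly set" where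
  "real_polys = {f. hstar f = f}"

definition holo_polys :: "'n zpoly set" where
  "holo_polys = {p. \<forall>(\<alpha>, \<beta>) \<in> Poly_Mapping.keys p. \<beta> = 0}"

text \<open>\<open>f(a)\<close> as a complex number; it is real for \<open>f \<in> real_polys\<close>.\<close>

definition zeval :: "('n::finite) zpoly \<Rightarrow> complex ^ 'n \<Rightarrow> complex" where
  "zeval f a = (\<Sum>(\<alpha>, \<beta>) \<in> Poly_Mapping.keys f.
     Poly_Mapping.lookup f (\<alpha>, \<beta>) * (\<Prod>j\<in>UNIV. vec_nth a j ^ Poly_Mapping.lookup \<alpha> j)
       * (\<Prod>j\<in>UNIV. cnj (vec_nth a j) ^ Poly_Mapping.lookup \<beta> j))"

lemma zeval_real:
  assumes "f \<in> real_polys"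
  shows "zeval f a \<in> \<real>"
proof -
  have sym: "Poly_Mapping.lookup f (\<alpha>, \<beta>) = cnj (Poly_Mapping.lookup f (\<beta>, \<alpha>))" for \<alpha> \<beta>
    using assms lookup_hstar[of f \<alpha> \<beta>] by (simp add: real_polys_def)
  have keys: "prod.swap ` Poly_Mapping.keys f = Poly_Mapping.keys f"
  proof -
    have "(\<beta>, \<alpha>) \<in> Poly_Mapping.keys f \<longleftrightarrow> (\<alpha>, \<beta>) \<in> Poly_Mapping.keys f" for \<alpha> \<beta>
      using sym[of \<alpha> \<beta>] by (simp add: in_keys_iff)
    then show ?thesis by force
  qed
  define g where "g = (\<lambda>(\<alpha>, \<beta>). Poly_Mapping.lookup f (\<alpha>, \<beta>)
      * (\<Prod>j\<in>UNIV. vec_nth a j ^ Poly_Mapping.lookup \<alpha> j)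
      * (\<Prod>j\<in>UNIV. cnj (vec_nth a j) ^ Poly_Mapping.lookup \<beta> j))"
  have "cnj (g k) = g (prod.swap k)" for k
  proof (cases k)
    case (Pair \<alpha> \<beta>)
    show ?thesis
      unfolding g_def Pair using sym[of \<beta> \<alpha>] by (simp add: mult_ac)
  qed
  then have "cnj (zeval f a) = (\<Sum>k\<in>Poly_Mapping.keys f. g (prod.swap k))"
    unfolding zeval_def g_def[symmetric] by (simp add: cnj_sum)
  also have "\<dots> = sum g (prod.swap ` Poly_Mapping.keys f)"
    by (subst sum.reindex) (auto simp: o_def)
  finally have "cnj (zeval f a) = zeval f a"
    unfolding keys by (simp add: zeval_def g_def)
  then show ?thesis by (simp add: Reals_cnj_iff)
qed

inductive_set Sigma_h :: "'n zpoly set" where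
  square: "p \<in> holo_polys \<Longrightarrow> p * hstar p \<in> Sigma_h"
| add: "f \<in> Sigma_h \<Longrightarrow> g \<in> Sigma_h \<Longrightarrow> f + g \<in> Sigma_h"
| scale: "f \<in> Sigma_h \<Longrightarrow> (c::real) \<ge> 0 \<Longrightarrow> Const (complex_of_real c) * f \<in> Sigma_h"

definition hermitian_module :: "'n zpoly set \<Rightarrow> bool" where
  "hermitian_module M \<longleftrightarrow> M \<subseteq> real_polys \<and> 1 \<in> M \<and>
     (\<forall>f\<in>M. \<forall>g\<in>M. f + g \<in> M) \<and> (\<forall>s\<in>Sigma_h. \<forall>f\<in>M. s * f \<in> M)"

definition fin_gen_hermitian_module :: "'n zpoly set \<Rightarrow> bool" where
  "fin_gen_hermitian_module M \<longleftrightarrow> hermitian_module M \<and>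
     (\<exists>F. finite F \<and> F \<subseteq> real_polys \<and> M = hermitian_module hull F)"

text \<open>
  Here and in \<open>psd\<close> below, \<open>0 \<le> w\<close> for complex \<open>w\<close> is the order of
  \<^theory>\<open>HOL-Library.Complex_Order\<close>: \<open>w\<close> is real and nonnegative.
\<close>

definition X_set :: "('n::finite) zpoly set \<Rightarrow> (complex ^ 'n) set" where
  "X_set M = {a. \<forall>g\<in>M. 0 \<le> zeval g a}"

text \<open>
  \<open>T\<^sup>\<alpha>\<close> for a tuple of \<open>k \<times> k\<close> matrices. The enumeration of the indices only fixes the order of
  the factors, which is immaterial when the matrices commute.
\<close>

definition index_list :: "('n::finite) list" where
  "index_list = (SOME js. distinct js \<and> set js = UNIV)"

definition mat_monom :: "nat \<Rightarrow> ('n::finite \<Rightarrow> complex mat) \<Rightarrow> ('n \<Rightarrow>\<^sub>0 nat) \<Rightarrow> complex mat" where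
  "mat_monom k T \<alpha> = foldr (\<lambda>j A. (T j ^\<^sub>m Poly_Mapping.lookup \<alpha> j) * A) index_list (1\<^sub>m k)"

text \<open>Hereditary calculus \<open>f(T, T*)\<close>: the sum of \<open>a\<^bsub>\<alpha>\<beta>\<^esub> T*\<^sup>\<beta> T\<^sup>\<alpha>\<close>, taken entrywise.\<close>

definition hereditary :: "nat \<Rightarrow> ('n::finite) zpoly \<Rightarrow> ('n \<Rightarrow> complex mat) \<Rightarrow> complex mat" where
  "hereditary k f T = mat k k (\<lambda>ij. \<Sum>(\<alpha>, \<beta>) \<in> Poly_Mapping.keys f.
     Poly_Mapping.lookup f (\<alpha>, \<beta>) * (mat_monom k (\<lambda>j. mat_adjoint (T j)) \<beta> * mat_monom k T \<alpha>) $$ ij)"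

text \<open>Requiring all values \<open>\<langle>Av, v\<rangle>\<close> to be real forces a complex matrix to be hermitian.\<close>

definition psd :: "nat \<Rightarrow> complex mat \<Rightarrow> bool" where
  "psd k A \<longleftrightarrow> A \<in> carrier_mat k k \<and> (\<forall>v\<in>carrier_vec k. 0 \<le> (A *\<^sub>v v) \<bullet>c v)"

definition normal_mat :: "complex mat \<Rightarrow> bool" where
  "normal_mat A \<longleftrightarrow> A * mat_adjoint A = mat_adjoint A * A"

definition Sf :: "('n::finite) zpoly set \<Rightarrow> bool" where
  "Sf M \<longleftrightarrow> (\<forall>k (T :: 'n \<Rightarrow> complex mat).
     (\<forall>j. T j \<in> carrier_mat k k) \<longrightarrow>
     (\<forall>i j. T i * T j = T j * T i) \<longrightarrow>
     (\<forall>p\<in>M. psd k (hereditary k p T)) \<longrightarrow>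
     (\<forall>j. normal_mat (T j)))"

definition analytic_disc :: "(complex ^ 'n::finite) set \<Rightarrow> bool" where
  "analytic_disc D \<longleftrightarrow> (\<exists>\<phi>. (\<forall>j. (\<lambda>w. vec_nth (\<phi> w) j) holomorphic_on ball 0 1) \<and>
     \<not> \<phi> constant_on ball 0 1 \<and> D = \<phi> ` ball 0 1)"

end

theory Submission
  imports Defs
begin

text \<open>
  Let \<open>\<phi>\<close> be a disc in \<open>X_set M\<close> and \<open>f\<^sub>1, \<dots>, f\<^sub>r\<close> generators of \<open>M\<close>. After shrinking the disc to
  an open set \<open>V\<close>, each \<open>f\<^sub>i \<circ> \<phi>\<close> is either identically zero or strictly positive on \<open>V\<close>. Choose
  \<open>a \<in> V\<close> with \<open>\<phi>' a \<noteq> 0\<close> and let \<open>T\<^sub>j\<close> be the upper triangular \<open>2 \<times> 2\<close> matrix with diagonal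
  \<open>\<phi>\<^sub>j a\<close> and upper right entry \<open>\<epsilon> \<phi>\<^sub>j' a\<close>, which is not normal if \<open>\<phi>\<^sub>j' a \<noteq> 0\<close>. Then
  \<open>f\<^sub>i(T, T*)\<close> is \<open>f\<^sub>i (\<phi> a)\<close> times the identity plus positive powers of \<open>\<epsilon>\<close> times Wirtinger
  derivatives of \<open>f\<^sub>i \<circ> \<phi>\<close> at \<open>a\<close>. It vanishes in the first case and is positive definite for
  small \<open>\<epsilon>\<close> in the second. Positivity passes from the generators to \<open>M\<close>.
\<close>

section \<open>Exponent vectors and the fixed ring of the involution\<close>

lemma sum_single_lookup:
  fixes \<alpha> :: "'n::finite \<Rightarrow>\<^sub>0 nat"
  shows "(\<Sum>j\<in>UNIV. Poly_Mapping.single j (Poly_Mapping.lookup \<alpha> j)) = \<alpha>"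
  by (rule poly_mapping_eqI) (auto simp: lookup_sum lookup_single when_def sum.delta)

lemma real_polys_add: "f \<in> real_polys \<Longrightarrow> g \<in> real_polys \<Longrightarrow> f + g \<in> real_polys"
  by (simp add: real_polys_def hstar_add)

lemma real_polys_mult: "f \<in> real_polys \<Longrightarrow> g \<in> real_polys \<Longrightarrow> f * g \<in> real_polys"
  by (simp add: real_polys_def hstar_mult)

lemma real_polys_one: "1 \<in> real_polys"
  using hstar_Const[of 1] by (simp add: real_polys_def Const_def)

lemma Sigma_h_real: "s \<in> Sigma_h \<Longrightarrow> s \<in> real_polys"
proof (induction rule: Sigma_h.induct)
  case (square p)
  then show ?case by (simp add: real_polys_def hstar_mult hstar_hstar mult.commute)
next
  case (add f g)
  then show ?case by (simp add: real_polys_add)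
next
  case (scale f c)
  then show ?case by (simp add: real_polys_def hstar_mult hstar_Const)
qed

subsection \<open>Linear functionals on polynomials\<close>

text \<open>Point values, entries of \<open>hereditary\<close> and Wirtinger derivatives are all
  linear functionals of this kind, determined by their values \<open>e\<close> on monomials, so one
  set of rules serves them all.\<close>

definition monom_sum :: "('k \<Rightarrow>\<^sub>0 complex) \<Rightarrow> ('k \<Rightarrow> complex) \<Rightarrow> complex" where
  "monom_sum f e = (\<Sum>k\<in>Poly_Mapping.keys f. Poly_Mapping.lookup f k * e k)"

lemma monom_sum_superset:
  assumes "finite K" "Poly_Mapping.keys f \<subseteq> K"
  shows "monom_sum f e = (\<Sum>k\<in>K. Poly_Mapping.lookup f k * e k)"
  unfolding monom_sum_def using assms
  by (intro sum.mono_neutral_left) (auto simp: in_keys_iff)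

lemma monom_sum_cong:
  "(\<And>k. k \<in> Poly_Mapping.keys f \<Longrightarrow> e k = e' k) \<Longrightarrow> monom_sum f e = monom_sum f e'"
  by (simp add: monom_sum_def)

lemma monom_sum_zero: "monom_sum 0 e = 0"
  by (simp add: monom_sum_def)

lemma monom_sum_single: "monom_sum (Poly_Mapping.single k c) e = c * e k"
  by (subst monom_sum_superset[where K = "{k}"]) (auto simp: lookup_single)

lemma monom_sum_add: "monom_sum (f + g) e = monom_sum f e + monom_sum g e"
  using Poly_Mapping.keys_add[of f g]
  by (subst (1 2 3) monom_sum_superset[where K = "Poly_Mapping.keys f \<union> Poly_Mapping.keys g"])
    (auto simp: lookup_add sum.distrib algebra_simps)

lemma monom_sum_sum: "monom_sum (\<Sum>i\<in>I. f i) e = (\<Sum>i\<in>I. monom_sum (f i) e)"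
  by (induction I rule: infinite_finite_induct) (auto simp: monom_sum_zero monom_sum_add)

lemma monom_sum_add_right: "monom_sum f (\<lambda>k. a k + b k) = monom_sum f a + monom_sum f b"
  by (simp add: monom_sum_def sum.distrib algebra_simps)

lemma monom_sum_mult_left: "monom_sum f (\<lambda>k. c * a k) = c * monom_sum f a"
  unfolding monom_sum_def sum_distrib_left by (simp add: mult_ac)

lemma monom_sum_mult_right: "monom_sum f (\<lambda>k. a k * c) = monom_sum f a * c"
  unfolding monom_sum_def sum_distrib_right by (simp add: mult_ac)

lemma sum_singles: "(\<Sum>k\<in>Poly_Mapping.keys f. Poly_Mapping.single k (Poly_Mapping.lookup f k)) = f"
  by (rule poly_mapping_eqI)
    (auto simp: lookup_sum lookup_single when_def sum.delta in_keys_iff)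

text \<open>Expanding both factors into single monomials reduces this to the addition of keys. The
  iterated form allows the inner functional to be computed for a fixed monomial of
  \<open>f\<close>.\<close>

lemma monom_sum_mult:
  "monom_sum (f * g) e = monom_sum f (\<lambda>k. monom_sum g (\<lambda>l. e (k + l)))"
proof -
  have "f * g = (\<Sum>k\<in>Poly_Mapping.keys f. \<Sum>l\<in>Poly_Mapping.keys g.
      Poly_Mapping.single (k + l) (Poly_Mapping.lookup f k * Poly_Mapping.lookup g l))"
    by (subst sum_singles[of f, symmetric], subst sum_singles[of g, symmetric])
      (simp add: sum_product mult_single)
  then show ?thesis
    by (simp add: monom_sum_sum monom_sum_single) 
      (simp add: monom_sum_def sum_distrib_left mult_ac)
qed

lemma monom_sum_hstar: "monom_sum (hstar f) e = cnj (monom_sum f (\<lambda>k. cnj (e (prod.swap k))))"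
proof -
  have keys: "Poly_Mapping.keys (hstar f) = prod.swap ` Poly_Mapping.keys f"
  proof -
    have "(\<alpha>, \<beta>) \<in> Poly_Mapping.keys (hstar f) \<longleftrightarrow> (\<beta>, \<alpha>) \<in> Poly_Mapping.keys f" for \<alpha> \<beta>
      by (simp add: in_keys_iff lookup_hstar)
    then show ?thesis by force
  qed
  have "Poly_Mapping.lookup (hstar f) (prod.swap k) = cnj (Poly_Mapping.lookup f k)" for k
    by (cases k) (simp add: lookup_hstar)
  then show ?thesis
    unfolding monom_sum_def keys by (subst sum.reindex) (auto simp: o_def cnj_sum)
qed

text \<open>For the expansion of a form in a small parameter, this symmetry makes the two
  first-order coefficients conjugate to each other and the second-order one real.\<close>

lemma monom_sum_real_swap:
  assumes "f \<in> real_polys"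
  shows "monom_sum f (\<lambda>k. cnj (e (prod.swap k))) = cnj (monom_sum f e)"
  using monom_sum_hstar[of f e] assms by (simp add: real_polys_def)

subsection \<open>Tangent vectors and triangular Toeplitz matrices\<close>

definition toep :: "complex \<Rightarrow> complex \<Rightarrow> complex mat" where
  "toep x y = mat 2 2 (\<lambda>(i, j). if i = j then x else if i = 0 then y else 0)"

lemma toep_carrier [simp]: "toep x y \<in> carrier_mat 2 2"
  by (simp add: toep_def)

lemma toep_dim [simp]: "dim_row (toep x y) = 2" "dim_col (toep x y) = 2"
  by (simp_all add: toep_def)

lemma toep_one: "1\<^sub>m 2 = toep 1 0"
  by (rule eq_matI) (auto simp: toep_def)

lemma toep_mult: "toep x y * toep x' y' = toep (x * x') (x * y' + y * x')"
  by (rule eq_matI) (auto simp: toep_def scalar_prod_def less_2_cases_iff numeral_2_eq_2)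

lemma adjoint_toep:
  "mat_adjoint (toep x y) = mat 2 2 (\<lambda>(i, j). if i = j then cnj x else if j = 0 then cnj y else 0)"
  by (rule eq_matI)
    (auto simp: toep_def mat_adjoint_def mat_of_rows_def conjugate_complex_def less_2_cases_iff)

lemma adjoint_toep_one: "1\<^sub>m 2 = mat_adjoint (toep 1 0)"
  by (rule eq_matI) (auto simp: adjoint_toep)

lemma adjoint_toep_mult:
  "mat_adjoint (toep x y) * mat_adjoint (toep x' y') = mat_adjoint (toep (x * x') (x * y' + y * x'))"
  unfolding adjoint_toep
  by (rule eq_matI) (auto simp: scalar_prod_def less_2_cases_iff numeral_2_eq_2)

text \<open>The upper left entries of the two products are \<open>|x|^2 + |y|^2\<close> and
  \<open>|x|^2\<close>.\<close>

lemma toep_not_normal: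
  assumes "y \<noteq> 0"
  shows "\<not> normal_mat (toep x y)"
proof
  assume "normal_mat (toep x y)"
  then have "(toep x y * mat_adjoint (toep x y)) $$ (0, 0) = (mat_adjoint (toep x y) * toep x y) $$ (0, 0)"
    by (simp add: normal_mat_def)
  then have "y * cnj y = 0"
    unfolding adjoint_toep by (simp add: toep_def scalar_prod_def numeral_2_eq_2 mult.commute)
  with assms show False by simp
qed

text \<open>The quadratic form of \<open>hereditary 2 f tuple\<close> on the vector
  \<open>v = (x, y)\<close>: \<open>T^\<alpha> v\<close> has the entries
  \<open>u \<alpha> * x + d \<alpha> * y\<close> and \<open>u \<alpha> * y\<close>, and each summand
  is its inner product with \<open>T^\<beta> v\<close>.\<close>

definition herm_form ::
  "(('n \<Rightarrow>\<^sub>0 nat) \<Rightarrow> complex) \<Rightarrow> (('n \<Rightarrow>\<^sub>0 nat) \<Rightarrow> complex) \<Rightarrow> 'n zpoly \<Rightarrow> complex \<Rightarrow> complex \<Rightarrow> complex"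
  where "herm_form u d f x y = monom_sum f (\<lambda>k.
     (u (fst k) * x + d (fst k) * y) * cnj (u (snd k) * x + d (snd k) * y)
     + u (fst k) * y * cnj (u (snd k) * y))"

text \<open>
  \<open>u\<close> is evaluation of monomials at a point and \<open>d\<close> a derivation of the monomials at that point;
  together they are a multiplicative map into the dual numbers, which \<open>toep\<close> represents by matrices.
\<close>

locale tangent_vector =
  fixes u d :: "('n::finite \<Rightarrow>\<^sub>0 nat) \<Rightarrow> complex"
  assumes u_zero: "u 0 = 1" and d_zero: "d 0 = 0"
    and u_add: "u (\<alpha> + \<beta>) = u \<alpha> * u \<beta>"
    and d_add: "d (\<alpha> + \<beta>) = u \<alpha> * d \<beta> + d \<alpha> * u \<beta>"
begin

definition tuple :: "'n \<Rightarrow> complex mat" where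
  "tuple j = toep (u (Poly_Mapping.single j 1)) (d (Poly_Mapping.single j 1))"

lemma toep_add: "toep (u (\<alpha> + \<beta>)) (d (\<alpha> + \<beta>)) = toep (u \<alpha>) (d \<alpha>) * toep (u \<beta>) (d \<beta>)"
  by (simp add: toep_mult u_add d_add)

lemma adjoint_toep_add: "mat_adjoint (toep (u (\<alpha> + \<beta>)) (d (\<alpha> + \<beta>)))
    = mat_adjoint (toep (u \<alpha>) (d \<alpha>)) * mat_adjoint (toep (u \<beta>) (d \<beta>))"
  by (simp add: adjoint_toep_mult u_add d_add)

lemma tuple_pow: "tuple j ^\<^sub>m m = toep (u (Poly_Mapping.single j m)) (d (Poly_Mapping.single j m))"
proof (induction m)
  case 0
  then show ?case by (simp add: tuple_def u_zero d_zero toep_one)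
next
  case (Suc m)
  have "Poly_Mapping.single j (Suc m) = Poly_Mapping.single j m + Poly_Mapping.single j 1"
    by (simp flip: single_add)
  with Suc show ?case by (simp only: pow_mat.simps toep_add tuple_def)
qed

lemma adjoint_tuple_pow: "mat_adjoint (tuple j) ^\<^sub>m m =
    mat_adjoint (toep (u (Poly_Mapping.single j m)) (d (Poly_Mapping.single j m)))"
proof (induction m)
  case 0
  then show ?case by (simp add: tuple_def u_zero d_zero adjoint_toep_one[symmetric])
    (simp add: adjoint_toep)
next
  case (Suc m)
  have "Poly_Mapping.single j (Suc m) = Poly_Mapping.single j m + Poly_Mapping.single j 1"
    by (simp flip: single_add)
  with Suc show ?case by (simp only: pow_mat.simps adjoint_toep_add tuple_def)
qed

lemma index_list: "distinct (index_list :: 'n list)" "set (index_list :: 'n list) = UNIV"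
proof -
  have "\<exists>js :: 'n list. distinct js \<and> set js = UNIV"
    using finite_distinct_list[of "UNIV :: 'n set"] by auto
  from someI_ex[OF this] show "distinct (index_list :: 'n list)" "set (index_list :: 'n list) = UNIV"
    unfolding index_list_def by auto
qed

lemma mat_monom_tuple: "mat_monom 2 tuple \<alpha> = toep (u \<alpha>) (d \<alpha>)"
proof -
  define s where "s j = Poly_Mapping.single j (Poly_Mapping.lookup \<alpha> j)" for j
  \<comment> \<open>Induction needs an arbitrary list; distinctness makes the sum over
    \<open>set js\<close> gain one term with each new element.\<close>
  have "foldr (\<lambda>j A. (tuple j ^\<^sub>m Poly_Mapping.lookup \<alpha> j) * A) js (1\<^sub>m 2)
      = toep (u (\<Sum>j\<in>set js. s j)) (d (\<Sum>j\<in>set js. s j))" if "distinct js" for js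
    using that
    by (induction js) (simp_all add: u_zero d_zero toep_one tuple_pow toep_add flip: s_def)
  from this[OF index_list(1)] show ?thesis
    by (simp add: mat_monom_def index_list(2) s_def sum_single_lookup)
qed

lemma mat_monom_adjoint_tuple:
  "mat_monom 2 (\<lambda>j. mat_adjoint (tuple j)) \<alpha> = mat_adjoint (toep (u \<alpha>) (d \<alpha>))"
proof -
  define s where "s j = Poly_Mapping.single j (Poly_Mapping.lookup \<alpha> j)" for j
  have "foldr (\<lambda>j A. (mat_adjoint (tuple j) ^\<^sub>m Poly_Mapping.lookup \<alpha> j) * A) js (1\<^sub>m 2)
      = mat_adjoint (toep (u (\<Sum>j\<in>set js. s j)) (d (\<Sum>j\<in>set js. s j)))" if "distinct js" for js
    using that
    by (induction js)
      (simp_all add: u_zero d_zero adjoint_toep_one adjoint_tuple_pow adjoint_toep_add flip: s_def)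
  from this[OF index_list(1)] show ?thesis
    by (simp add: mat_monom_def index_list(2) s_def sum_single_lookup)
qed

lemma tuple_commute: "tuple i * tuple j = tuple j * tuple i"
  by (simp add: tuple_def toep_mult algebra_simps)

text \<open>Since all adjoints stand on the left, a monomial contributes the inner product of
  \<open>T^\<alpha> v\<close> and \<open>T^\<beta> v\<close>. The proof computes the four matrix
  entries.\<close>

lemma hereditary_tuple_form:
  assumes v: "v \<in> carrier_vec 2"
  shows "(hereditary 2 f tuple *\<^sub>v v) \<bullet>c v = herm_form u d f (vec_index v 0) (vec_index v 1)"
proof -
  have dv: "dim_vec v = 2" using v by auto
  define H where "H = hereditary 2 f tuple"
  define E where "E i j k = (mat_adjoint (toep (u (snd k)) (d (snd k))) * toep (u (fst k)) (d (fst k))) $$ (i, j)"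
    for i j k
  have H: "H $$ (i, j) = monom_sum f (E i j)" if "i < 2" "j < 2" for i j
    using that
    by (simp add: H_def hereditary_def mat_monom_tuple mat_monom_adjoint_tuple monom_sum_def E_def
        case_prod_beta)
  have E: "E 0 0 k = cnj (u (snd k)) * u (fst k)" "E 0 1 k = cnj (u (snd k)) * d (fst k)"
     "E 1 0 k = cnj (d (snd k)) * u (fst k)"
     "E 1 1 k = cnj (d (snd k)) * d (fst k) + cnj (u (snd k)) * u (fst k)" for k
    by (simp_all add: E_def adjoint_toep) (simp_all add: toep_def scalar_prod_def numeral_2_eq_2)
  have "(H *\<^sub>v v) \<bullet>c v = (\<Sum>i<2. (\<Sum>j<2. H $$ (i, j) * vec_index v j) * cnj (vec_index v i))"
    using dv by (simp add: scalar_prod_def H_def hereditary_def conjugate_complex_def lessThan_atLeast0)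
  also have "\<dots> = (\<Sum>i<2. \<Sum>j<2. monom_sum f (\<lambda>k. E i j k * (vec_index v j * cnj (vec_index v i))))"
    by (simp add: H monom_sum_mult_right sum_distrib_right mult.assoc)
  also have "\<dots> = herm_form u d f (vec_index v 0) (vec_index v 1)"
    by (simp add: herm_form_def numeral_2_eq_2 E[simplified] algebra_simps flip: monom_sum_add_right)
  finally show ?thesis by (simp add: H_def)
qed

lemma psd_hereditary_tuple:
  assumes "\<And>x y. 0 \<le> herm_form u d f x y"
  shows "psd 2 (hereditary 2 f tuple)"
  using assms by (auto simp: psd_def hereditary_tuple_form) (simp add: hereditary_def)

lemma herm_form_add: "herm_form u d (f + g) x y = herm_form u d f x y + herm_form u d g x y"
  by (simp add: herm_form_def monom_sum_add)

lemma herm_form_Const_mult: "herm_form u d (Const c * f) x y = c * herm_form u d f x y"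
  by (simp add: herm_form_def monom_sum_mult Const_def monom_sum_single)

lemma herm_form_one: "herm_form u d 1 x y = of_real ((cmod x)\<^sup>2 + (cmod y)\<^sup>2)"
proof -
  have "herm_form u d 1 x y = x * cnj x + y * cnj y"
    by (simp add: herm_form_def monom_sum_single u_zero d_zero flip: single_one)
  then show ?thesis
    by (simp only: of_real_add complex_norm_square)
qed

text \<open>Multiplying \<open>f\<close> by \<open>p * hstar p\<close> puts \<open>p(T)\<close> to
  the right of the matrix of \<open>f\<close> and its adjoint to the left. The form of
  \<open>f\<close> is therefore evaluated at \<open>p(T) v\<close>, where \<open>p(T)\<close> is
  \<open>toep u' d'\<close>.\<close>

lemma herm_form_square_mult:
  assumes "p \<in> holo_polys"
  defines "u' \<equiv> monom_sum p (\<lambda>k. u (fst k))" and "d' \<equiv> monom_sum p (\<lambda>k. d (fst k))"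
  shows "herm_form u d (p * hstar p * f) x y = herm_form u d f (u' * x + d' * y) (u' * y)"
proof -
  have p0: "snd k = 0" if "k \<in> Poly_Mapping.keys p" for k
    using that assms by (auto simp: holo_polys_def)
  define X where "X \<alpha> = u \<alpha> * x + d \<alpha> * y" for \<alpha>
  have sX: "monom_sum p (\<lambda>k. X (\<alpha> + fst k)) = u \<alpha> * (u' * x + d' * y) + d \<alpha> * (u' * y)" for \<alpha>
  proof -
    have "monom_sum p (\<lambda>k. X (\<alpha> + fst k))
        = monom_sum p (\<lambda>k. u (fst k) * (u \<alpha> * x + d \<alpha> * y) + d (fst k) * (u \<alpha> * y))"
      by (simp add: X_def u_add d_add algebra_simps)
    then show ?thesis
      by (simp only: monom_sum_add_right monom_sum_mult_right u'_def d'_def) (simp add: algebra_simps)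
  qed
  have sY: "monom_sum p (\<lambda>k. u (\<alpha> + fst k) * y) = u \<alpha> * (u' * y)" for \<alpha>
  proof -
    have "monom_sum p (\<lambda>k. u (\<alpha> + fst k) * y) = monom_sum p (\<lambda>k. u (fst k) * (u \<alpha> * y))"
      by (simp add: u_add algebra_simps)
    then show ?thesis
      by (simp only: monom_sum_mult_right u'_def) (simp add: algebra_simps)
  qed
  \<comment> \<open>The double sum factors because \<open>k\<close> and \<open>l\<close> are
    separated in each product.\<close>
  have inner: "monom_sum p (\<lambda>k. cnj (monom_sum p (\<lambda>l. cnj (a k * cnj (b l) + a' k * cnj (b' l)))))
      = monom_sum p a * cnj (monom_sum p b) + monom_sum p a' * cnj (monom_sum p b')" for a b a' b'
    by (simp add: monom_sum_add_right monom_sum_mult_left monom_sum_mult_right)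
  \<comment> \<open>With \<open>f\<close> in front, its sum becomes the outer one and the two inner
    sums run over \<open>p\<close>.\<close>
  have "herm_form u d (p * hstar p * f) x y = herm_form u d (f * (p * hstar p)) x y"
    by (simp add: mult.commute)
  also have "\<dots> = monom_sum f (\<lambda>m. monom_sum p (\<lambda>k. cnj (monom_sum p (\<lambda>l. cnj
      (X (fst m + (fst k + snd l)) * cnj (X (snd m + (snd k + fst l)))
       + u (fst m + (fst k + snd l)) * y * cnj (u (snd m + (snd k + fst l)) * y))))))"
    unfolding herm_form_def X_def by (simp add: monom_sum_mult monom_sum_hstar)
  \<comment> \<open>Holomorphy of \<open>p\<close> removes \<open>snd k\<close> and
    \<open>snd l\<close>, which separates the variables as \<open>inner\<close> requires.\<close>
  also have "\<dots> = monom_sum f (\<lambda>m. monom_sum p (\<lambda>k. cnj (monom_sum p (\<lambda>l. cnj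
      (X (fst m + fst k) * cnj (X (snd m + fst l))
       + u (fst m + fst k) * y * cnj (u (snd m + fst l) * y))))))"
    by (intro monom_sum_cong arg_cong[where f = cnj]) (simp add: p0)
  also have "\<dots> = herm_form u d f (u' * x + d' * y) (u' * y)"
    by (simp only: inner sX sY herm_form_def)
  finally show ?thesis .
qed

text \<open>Multiplication by a square only moves the vector, so nonnegativity at all vectors is
  preserved. Being a module, this set contains the hull of each of its subsets.\<close>

lemma hermitian_module_form_nonneg:
  "hermitian_module {f \<in> real_polys. \<forall>x y. 0 \<le> herm_form u d f x y}"
proof -
  have mult: "\<forall>x y. 0 \<le> herm_form u d (s * f) x y"
    if "s \<in> Sigma_h" and f: "\<forall>x y. 0 \<le> herm_form u d f x y" for s f
    using that(1)
  proof (induction rule: Sigma_h.induct)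
    case (square p)
    then show ?case using f by (simp add: herm_form_square_mult)
  next
    case (add g h)
    then show ?case by (simp add: distrib_right herm_form_add)
  next
    case (scale g c)
    then show ?case
      by (simp add: mult.assoc herm_form_Const_mult less_eq_complex_def)
  qed
  have real: "s * f \<in> real_polys" if "s \<in> Sigma_h" "f \<in> real_polys" for s f :: "'n zpoly"
    using that by (simp add: real_polys_mult Sigma_h_real)
  show ?thesis
    unfolding hermitian_module_def
    using mult real
    by (auto simp: real_polys_one herm_form_one real_polys_add herm_form_add less_eq_complex_def)
qed

text \<open>The witness against \<open>Sf\<close> is \<open>tuple\<close>: positivity spreads from
  \<open>F\<close> to the hull by minimality, while the nonzero entry above the diagonal of
  \<open>tuple j\<close> excludes normality.\<close>

lemma not_Sf_if_form_nonneg: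
  assumes F: "F \<subseteq> real_polys" and nn: "\<And>f x y. f \<in> F \<Longrightarrow> 0 \<le> herm_form u d f x y"
    and j: "d (Poly_Mapping.single j 1) \<noteq> 0"
  shows "\<not> Sf (hermitian_module hull F)"
proof
  assume Sf: "Sf (hermitian_module hull F)"
  have "hermitian_module hull F \<subseteq> {f \<in> real_polys. \<forall>x y. 0 \<le> herm_form u d f x y}"
    using F nn by (intro hull_minimal hermitian_module_form_nonneg) auto
  then have "\<forall>p\<in>hermitian_module hull F. psd 2 (hereditary 2 p tuple)"
    by (auto intro: psd_hereditary_tuple)
  moreover have "\<forall>j. tuple j \<in> carrier_mat 2 2"
    by (simp add: tuple_def)
  ultimately have "normal_mat (tuple j)"
    using Sf tuple_commute unfolding Sf_def by blast
  then show False
    using toep_not_normal[OF j] by (simp add: tuple_def)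
qed

end

section \<open>Positivity for short tangent vectors\<close>

text \<open>When \<open>u\<close> and \<open>d\<close> come from a disc, the coefficients are the
  value of \<open>f\<close> along the disc, its two first Wirtinger derivatives and its mixed second
  derivative.\<close>

lemma herm_form_scale:
  fixes e :: real
  shows "herm_form u (\<lambda>\<alpha>. of_real e * d \<alpha>) f x y =
    monom_sum f (\<lambda>k. u (fst k) * cnj (u (snd k))) * (x * cnj x + y * cnj y)
    + of_real e * (monom_sum f (\<lambda>k. d (fst k) * cnj (u (snd k))) * (y * cnj x)
                 + monom_sum f (\<lambda>k. u (fst k) * cnj (d (snd k))) * (x * cnj y))
    + (of_real e)\<^sup>2 * (monom_sum f (\<lambda>k. d (fst k) * cnj (d (snd k))) * (y * cnj y))"
  unfolding herm_form_def monom_sum_def sum_distrib_left sum_distrib_right sum.distrib[symmetric]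
  by (rule sum.cong) (simp_all add: algebra_simps power2_eq_square)

text \<open>The leading term dominates for small \<open>e\<close>. All error bounds are multiples of
  \<open>|x|^2 + |y|^2\<close>, so one threshold for \<open>e\<close> serves all \<open>x\<close>
  and \<open>y\<close>.\<close>

lemma eventually_herm_form_nonneg:
  assumes f: "f \<in> real_polys" and g: "0 < monom_sum f (\<lambda>k. u (fst k) * cnj (u (snd k)))"
  shows "\<forall>\<^sub>F e in at_right (0::real). \<forall>x y. 0 \<le> herm_form u (\<lambda>\<alpha>. of_real e * d \<alpha>) f x y"
proof -
  define P where "P = monom_sum f (\<lambda>k. d (fst k) * cnj (u (snd k)))"
  have Q: "monom_sum f (\<lambda>k. u (fst k) * cnj (d (snd k))) = cnj P"
    using monom_sum_real_swap[OF f, of "\<lambda>k. d (fst k) * cnj (u (snd k))"]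
    by (simp add: P_def mult.commute)
  have "cnj (monom_sum f (\<lambda>k. d (fst k) * cnj (d (snd k)))) = monom_sum f (\<lambda>k. d (fst k) * cnj (d (snd k)))"
    using monom_sum_real_swap[OF f, of "\<lambda>k. d (fst k) * cnj (d (snd k))"]
    by (simp add: mult.commute)
  then obtain r where r: "monom_sum f (\<lambda>k. d (fst k) * cnj (d (snd k))) = of_real r"
    by (metis Reals_cnj_iff Reals_cases)
  obtain G where G: "monom_sum f (\<lambda>k. u (fst k) * cnj (u (snd k))) = of_real G" "G > 0"
    using g that[of "Re (monom_sum f (\<lambda>k. u (fst k) * cnj (u (snd k))))"]
    by (simp add: less_complex_def complex_eq_iff)
  \<comment> \<open>As \<open>e < 1\<close> gives \<open>e^2 \<le> e\<close>, the two error terms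
    together are at most \<open>e * (cmod P + \<bar>r\<bar>)\<close> times
    \<open>|x|^2 + |y|^2\<close>.\<close>
  have nonneg: "0 \<le> herm_form u (\<lambda>\<alpha>. of_real e * d \<alpha>) f x y"
    if e: "0 < e" "e < 1" "e * (cmod P + \<bar>r\<bar>) < G" for e x y
  proof -
    have eq: "herm_form u (\<lambda>\<alpha>. of_real e * d \<alpha>) f x y =
      of_real (G * ((cmod x)\<^sup>2 + (cmod y)\<^sup>2) + e * (2 * Re (P * (y * cnj x))) + e\<^sup>2 * r * (cmod y)\<^sup>2)"
    proof -
      have "P * (y * cnj x) + cnj P * (x * cnj y) = of_real (2 * Re (P * (y * cnj x)))"
        using complex_add_cnj[of "P * (y * cnj x)"] by (simp add: mult_ac)
      then show ?thesis
        by (simp add: herm_form_scale Q r G(1) flip: P_def complex_norm_square)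
    qed
    have "\<bar>Re (P * (y * cnj x))\<bar> \<le> cmod P * (cmod x * cmod y)"
      using abs_Re_le_cmod[of "P * (y * cnj x)"] by (simp add: norm_mult mult_ac)
    also have "cmod P * (cmod x * cmod y) \<le> cmod P * (((cmod x)\<^sup>2 + (cmod y)\<^sup>2) / 2)"
      using sum_squares_bound[of "cmod x" "cmod y"] by (intro mult_left_mono) auto
    finally have "\<bar>2 * Re (P * (y * cnj x))\<bar> \<le> cmod P * ((cmod x)\<^sup>2 + (cmod y)\<^sup>2)"
      unfolding abs_mult by linarith
    then have 1: "- (e * (cmod P * ((cmod x)\<^sup>2 + (cmod y)\<^sup>2))) \<le> e * (2 * Re (P * (y * cnj x)))"
      using e(1) by (metis abs_le_D2 minus_le_iff mult_left_mono mult_minus_right less_imp_le)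
    have "e\<^sup>2 * \<bar>r\<bar> \<le> e * \<bar>r\<bar>"
      using e by (intro mult_right_mono) (auto simp: power2_eq_square)
    then have "\<bar>e\<^sup>2 * r\<bar> * (cmod y)\<^sup>2 \<le> e * \<bar>r\<bar> * ((cmod x)\<^sup>2 + (cmod y)\<^sup>2)"
      using e by (intro mult_mono) (auto simp: abs_mult)
    then have 2: "- (e * \<bar>r\<bar> * ((cmod x)\<^sup>2 + (cmod y)\<^sup>2)) \<le> e\<^sup>2 * r * (cmod y)\<^sup>2"
      using abs_ge_minus_self[of "e\<^sup>2 * r * (cmod y)\<^sup>2"] by (simp add: abs_mult)
    have "e * (cmod P + \<bar>r\<bar>) * ((cmod x)\<^sup>2 + (cmod y)\<^sup>2) \<le> G * ((cmod x)\<^sup>2 + (cmod y)\<^sup>2)"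
      using e by (intro mult_right_mono) auto
    with 1 2 show ?thesis
      unfolding eq by (simp add: less_eq_complex_def algebra_simps)
  qed
  have "\<forall>\<^sub>F e in at_right (0::real). e * (cmod P + \<bar>r\<bar>) < G"
    using G(2) by (intro order_tendstoD[where y = "0 * (cmod P + \<bar>r\<bar>)"] tendsto_intros) auto
  moreover have "\<forall>\<^sub>F e in at_right (0::real). e < 1"
    by (intro order_tendstoD[where y = 0] tendsto_intros) auto
  ultimately show ?thesis
    using eventually_at_right_less[of "0::real"]
    by eventually_elim (use nonneg in blast)
qed

subsection \<open>Wirtinger derivatives and analytic discs\<close>

text \<open>
  The real derivative in direction \<open>v\<close> is \<open>P v + Q cnj v\<close>; taking \<open>v = 1\<close> and \<open>v = \<i>\<close>
  separates \<open>P\<close> and \<open>Q\<close>.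
\<close>

lemma wirtinger_vanish:
  assumes U: "open U" "a \<in> U"
    and h: "\<And>k. h k holomorphic_on U" and l: "\<And>k. l k holomorphic_on U"
    and vanish: "\<And>w. w \<in> U \<Longrightarrow> monom_sum f (\<lambda>k. h k w * cnj (l k w)) = 0"
  shows "monom_sum f (\<lambda>k. deriv (h k) a * cnj (l k a)) = 0"
    and "monom_sum f (\<lambda>k. h k a * cnj (deriv (l k) a)) = 0"
proof -
  define P where "P = monom_sum f (\<lambda>k. deriv (h k) a * cnj (l k a))"
  define Q where "Q = monom_sum f (\<lambda>k. h k a * cnj (deriv (l k) a))"
  have "(h k has_derivative (\<lambda>v. deriv (h k) a * v)) (at a)" for k
    using holomorphic_derivI[OF h U] by (simp add: has_field_derivative_def)
  moreover have "((\<lambda>w. cnj (l k w)) has_derivative (\<lambda>v. cnj (deriv (l k) a * v))) (at a)" for k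
    using holomorphic_derivI[OF l U]
    by (intro bounded_linear.has_derivative[OF bounded_linear_cnj]) (simp add: has_field_derivative_def)
  ultimately have "((\<lambda>w. monom_sum f (\<lambda>k. h k w * cnj (l k w))) has_derivative
      (\<lambda>v. \<Sum>k\<in>Poly_Mapping.keys f. Poly_Mapping.lookup f k *
         (h k a * cnj (deriv (l k) a * v) + deriv (h k) a * v * cnj (l k a)))) (at a)"
    unfolding monom_sum_def
    by (intro has_derivative_sum has_derivative_mult_right has_derivative_mult)
  moreover have "(\<lambda>v. \<Sum>k\<in>Poly_Mapping.keys f. Poly_Mapping.lookup f k *
         (h k a * cnj (deriv (l k) a * v) + deriv (h k) a * v * cnj (l k a)))
      = (\<lambda>v. P * v + Q * cnj v)"
    unfolding P_def Q_def monom_sum_def sum_distrib_left sum_distrib_right sum.distrib[symmetric]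
    by (intro ext sum.cong) (simp_all add: algebra_simps)
  ultimately have "((\<lambda>w. monom_sum f (\<lambda>k. h k w * cnj (l k w))) has_derivative
      (\<lambda>v. P * v + Q * cnj v)) (at a)"
    by simp
  then have "((\<lambda>w. 0) has_derivative (\<lambda>v. P * v + Q * cnj v)) (at a)"
    by (rule has_derivative_transform_within_open[OF _ U]) (simp add: vanish)
  then have "(\<lambda>v. P * v + Q * cnj v) = (\<lambda>v. 0)"
    by (rule has_derivative_unique) (rule has_derivative_const)
  then have "P * 1 + Q * cnj 1 = 0" "P * \<i> + Q * cnj \<i> = 0"
    by metis+
  then have "P + Q = 0" "P - Q = 0"
    by (simp_all add: algebra_simps)
  then have "P = 0" "Q = 0"
    by auto
  then show "monom_sum f (\<lambda>k. deriv (h k) a * cnj (l k a)) = 0"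
    and "monom_sum f (\<lambda>k. h k a * cnj (deriv (l k) a)) = 0"
    by (simp_all add: P_def Q_def)
qed

text \<open>Both alternatives pass to smaller sets, so the functions can be treated one at a time:
  unless \<open>g i\<close> vanishes on all of \<open>V\<close>, the part of \<open>V\<close> where
  it is nonzero is open and nonempty and replaces \<open>V\<close>.\<close>

lemma open_subset_zero_or_nonzero:
  fixes g :: "'i \<Rightarrow> 'a::topological_space \<Rightarrow> 'b::{t1_space, zero}"
  assumes "finite I" "open U" "U \<noteq> {}" "\<And>i. i \<in> I \<Longrightarrow> continuous_on U (g i)"
  shows "\<exists>V\<subseteq>U. open V \<and> V \<noteq> {} \<and> (\<forall>i\<in>I. (\<forall>w\<in>V. g i w = 0) \<or> (\<forall>w\<in>V. g i w \<noteq> 0))"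
  using assms(1,4)
proof (induction I rule: finite_induct)
  case empty
  then show ?case using assms by auto
next
  case (insert i I)
  then obtain V where V: "V \<subseteq> U" "open V" "V \<noteq> {}"
    "\<forall>i\<in>I. (\<forall>w\<in>V. g i w = 0) \<or> (\<forall>w\<in>V. g i w \<noteq> 0)"
    by auto
  show ?case
  proof (cases "\<forall>w\<in>V. g i w = 0")
    case True
    then show ?thesis using V by blast
  next
    case False
    have "continuous_on V (g i)"
      using insert.prems V(1) continuous_on_subset by blast
    then have "open (V \<inter> g i -` (- {0}))"
      using V(2) by (intro continuous_open_preimage) auto
    moreover have "V \<inter> g i -` (- {0}) \<noteq> {}"
      using False by auto
    ultimately show ?thesis
      using V by (intro exI[of _ "V \<inter> g i -` (- {0})"]) blast
  qed
qed

text \<open>The identity theorem for \<open>deriv h\<close> spreads its vanishing from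
  \<open>V\<close> to \<open>S\<close>.\<close>

lemma holomorphic_constant_if_deriv_zero_open:
  assumes h: "h holomorphic_on S" and S: "open S" "convex S"
    and V: "open V" "V \<noteq> {}" "V \<subseteq> S" and zero: "\<And>w. w \<in> V \<Longrightarrow> deriv h w = 0"
  shows "h constant_on S"
proof -
  obtain v where v: "v \<in> V" using V by auto
  have dh: "deriv h holomorphic_on S"
    using h S by (simp add: holomorphic_deriv)
  have "v islimpt V"
    using v V(1) by (simp add: interior_open interior_limit_point)
  then have "deriv h w = 0" if "w \<in> S" for w
    using analytic_continuation[OF dh S(1) convex_connected[OF S(2)] V(3), of v w] v V(3) zero that
    by blast
  then have "(h has_field_derivative 0) (at w within S)" if "w \<in> S" for w
    using holomorphic_derivI[OF h S(1) that] that by (simp add: has_field_derivative_at_within)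
  then show ?thesis
    using has_field_derivative_zero_constant[OF S(2)] by (metis constant_on_def)
qed

section \<open>From an analytic disc to a tangent vector\<close>

theorem theorem6p20:
  fixes M :: "('n::finite) zpoly set"
  assumes "fin_gen_hermitian_module M"
    and "Sf M"
  shows "\<not> (\<exists>D. analytic_disc D \<and> D \<subseteq> X_set M)"
proof
  assume "\<exists>D. analytic_disc D \<and> D \<subseteq> X_set M"
  then obtain \<phi> :: "complex \<Rightarrow> complex ^ 'n"
    where hol: "\<And>j. (\<lambda>w. vec_nth (\<phi> w) j) holomorphic_on ball 0 1"
      and nonconst: "\<not> \<phi> constant_on ball 0 1" and sub: "\<phi> ` ball 0 1 \<subseteq> X_set M"
    unfolding analytic_disc_def by blast
  obtain F where F: "finite F" "F \<subseteq> real_polys" "M = hermitian_module hull F"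
    using assms(1) by (auto simp: fin_gen_hermitian_module_def)
  \<comment> \<open>The monomial \<open>z^\<alpha>\<close> pulled back along \<open>\<phi>\<close>;
    likewise \<open>g f\<close> below is the pullback of \<open>f\<close>.\<close>
  define m where "m \<alpha> w = (\<Prod>j\<in>UNIV. vec_nth (\<phi> w) j ^ Poly_Mapping.lookup \<alpha> j)"
    for \<alpha> :: "'n \<Rightarrow>\<^sub>0 nat" and w
  have m_hol: "m \<alpha> holomorphic_on ball 0 1" for \<alpha>
    unfolding m_def[abs_def] by (intro holomorphic_intros hol)
  have m_add: "m (\<alpha> + \<beta>) = (\<lambda>w. m \<alpha> w * m \<beta> w)" for \<alpha> \<beta>
    by (rule ext) (simp add: m_def lookup_add power_add prod.distrib)
  have m_zero: "m 0 = (\<lambda>w. 1)"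
    by (rule ext) (simp add: m_def)
  have m_single: "m (Poly_Mapping.single j 1) = (\<lambda>w. vec_nth (\<phi> w) j)" for j
  proof
    fix w
    have "m (Poly_Mapping.single j 1) w = (\<Prod>i\<in>UNIV. if i = j then vec_nth (\<phi> w) i else 1)"
      unfolding m_def by (intro prod.cong) (auto simp: lookup_single)
    then show "m (Poly_Mapping.single j 1) w = vec_nth (\<phi> w) j"
      by simp
  qed
  define g where "g f w = monom_sum f (\<lambda>k. m (fst k) w * cnj (m (snd k) w))" for f w
  have g_nonneg: "0 \<le> g f w" if "f \<in> F" "w \<in> ball 0 1" for f w
  proof -
    have "f \<in> M" using that F(3) by (simp add: hull_inc)
    then have "0 \<le> zeval f (\<phi> w)" using sub that unfolding X_set_def by blast
    then show ?thesis
      by (simp add: g_def zeval_def m_def monom_sum_def case_prod_beta mult.assoc cnj_prod)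
  qed
  have "continuous_on (ball 0 1) (g f)" for f
    unfolding g_def[abs_def] monom_sum_def
    by (intro continuous_intros holomorphic_on_imp_continuous_on m_hol)
  then have "\<exists>V\<subseteq>ball 0 1. open V \<and> V \<noteq> {} \<and> (\<forall>f\<in>F. (\<forall>w\<in>V. g f w = 0) \<or> (\<forall>w\<in>V. g f w \<noteq> 0))"
    by (intro open_subset_zero_or_nonzero F(1)) auto
  then obtain V where V: "V \<subseteq> ball 0 1" "open V" "V \<noteq> {}"
    and dich: "\<And>f. f \<in> F \<Longrightarrow> (\<forall>w\<in>V. g f w = 0) \<or> (\<forall>w\<in>V. g f w \<noteq> 0)"
    by blast
  have "\<exists>j. \<exists>a\<in>V. deriv (\<lambda>w. vec_nth (\<phi> w) j) a \<noteq> 0"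
  proof (rule ccontr)
    assume "\<not> (\<exists>j. \<exists>a\<in>V. deriv (\<lambda>w. vec_nth (\<phi> w) j) a \<noteq> 0)"
    then have "(\<lambda>w. vec_nth (\<phi> w) j) constant_on ball 0 1" for j
      using holomorphic_constant_if_deriv_zero_open[OF hol, of V j] V by auto
    then obtain c where "\<And>j w. w \<in> ball 0 1 \<Longrightarrow> vec_nth (\<phi> w) j = c j"
      unfolding constant_on_def by metis
    then have "\<forall>w\<in>ball 0 1. \<phi> w = (\<chi> j. c j)"
      by (simp add: Finite_Cartesian_Product.vec_eq_iff)
    then show False using nonconst by (auto simp: constant_on_def)
  qed
  then obtain j a where a: "a \<in> V" and ja: "deriv (\<lambda>w. vec_nth (\<phi> w) j) a \<noteq> 0"
    by blast
  have a1: "a \<in> ball 0 1" using a V by auto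
  \<comment> \<open>Evaluation at \<open>\<phi> a\<close> and differentiation along the disc; the
    Leibniz rule for \<open>d\<close> is the product rule at \<open>a\<close>.\<close>
  define u where "u \<alpha> = m \<alpha> a" for \<alpha>
  define d where "d \<alpha> = deriv (m \<alpha>) a" for \<alpha>
  have tv: "tangent_vector u (\<lambda>\<alpha>. of_real e * d \<alpha>)" for e :: real
  proof
    show "u 0 = 1" "of_real e * d 0 = 0"
      by (simp_all add: u_def d_def m_zero)
    show "u (\<alpha> + \<beta>) = u \<alpha> * u \<beta>" for \<alpha> \<beta>
      by (simp add: u_def m_add)
    have "m \<alpha> field_differentiable (at a)" for \<alpha>
      by (rule holomorphic_on_imp_differentiable_at[OF m_hol open_ball a1])
    then have "d (\<alpha> + \<beta>) = u \<alpha> * d \<beta> + d \<alpha> * u \<beta>" for \<alpha> \<beta>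
      by (simp add: u_def d_def m_add deriv_mult)
    then show "of_real e * d (\<alpha> + \<beta>) = u \<alpha> * (of_real e * d \<beta>) + of_real e * d \<alpha> * u \<beta>" for \<alpha> \<beta>
      by (simp add: algebra_simps)
  qed
  have "\<forall>\<^sub>F e in at_right (0::real). \<forall>x y. 0 \<le> herm_form u (\<lambda>\<alpha>. of_real e * d \<alpha>) f x y"
    if f: "f \<in> F" for f
  proof (cases "\<forall>w\<in>V. g f w = 0")
    case True
    \<comment> \<open>Here all four coefficients in \<open>herm_form_scale\<close> vanish, so the
      form is zero for every \<open>e\<close>.\<close>
    have mV: "m \<alpha> holomorphic_on V" "deriv (m \<alpha>) holomorphic_on V" for \<alpha>
      using m_hol V holomorphic_on_subset holomorphic_deriv by (blast, blast)
    have g0: "monom_sum f (\<lambda>k. m (fst k) w * cnj (m (snd k) w)) = 0" if "w \<in> V" for w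
      using True that by (simp add: g_def)
    have P0: "monom_sum f (\<lambda>k. deriv (m (fst k)) w * cnj (m (snd k) w)) = 0"
      and Q0: "monom_sum f (\<lambda>k. m (fst k) w * cnj (deriv (m (snd k)) w)) = 0" if "w \<in> V" for w
      using wirtinger_vanish[OF V(2) that, of "\<lambda>k. m (fst k)" "\<lambda>k. m (snd k)" f] mV g0 by auto
    \<comment> \<open>\<open>P0\<close> holds on all of the open set \<open>V\<close>, so it can be
      differentiated once more, now in the conjugate variable.\<close>
    have R0: "monom_sum f (\<lambda>k. deriv (m (fst k)) a * cnj (deriv (m (snd k)) a)) = 0"
      using wirtinger_vanish(2)[OF V(2) a, of "\<lambda>k. deriv (m (fst k))" "\<lambda>k. m (snd k)" f] mV P0
      by auto
    show ?thesis
      using a by (simp add: herm_form_scale u_def d_def g0 P0 Q0 R0)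
  next
    case False
    then have "g f a \<noteq> 0" using dich[OF f] a by blast
    then have "0 < g f a" using g_nonneg[OF f a1] by simp
    then show ?thesis
      using F(2) f by (intro eventually_herm_form_nonneg) (auto simp: g_def u_def)
  qed
  \<comment> \<open>Finiteness of \<open>F\<close> yields a single \<open>e\<close> for all
    generators.\<close>
  then have "\<forall>\<^sub>F e in at_right (0::real). \<forall>f\<in>F. \<forall>x y. 0 \<le> herm_form u (\<lambda>\<alpha>. of_real e * d \<alpha>) f x y"
    using F(1) by (simp add: eventually_ball_finite)
  with eventually_at_right_less[of "0::real"]
  have "\<forall>\<^sub>F e in at_right (0::real). 0 < e \<and>
      (\<forall>f\<in>F. \<forall>x y. 0 \<le> herm_form u (\<lambda>\<alpha>. of_real e * d \<alpha>) f x y)"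
    by eventually_elim simp
  from eventually_happens'[OF trivial_limit_at_right_real this]
  obtain e :: real where e: "0 < e"
    "\<And>f x y. f \<in> F \<Longrightarrow> 0 \<le> herm_form u (\<lambda>\<alpha>. of_real e * d \<alpha>) f x y"
    by (elim exE conjE) simp
  interpret tangent_vector u "\<lambda>\<alpha>. of_real e * d \<alpha>" by (rule tv)
  have dj: "of_real e * d (Poly_Mapping.single j 1) \<noteq> 0"
    using e(1) ja unfolding d_def m_single by simp
  have "\<not> Sf M"
    unfolding F(3) by (rule not_Sf_if_form_nonneg[OF F(2) e(2) dj])
  then show False using assms(2) by simp
qed

end
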